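(* Let $\Phi$ be a Følner sequence on $\mathbb{N}$ and let $h\in\mathsf{Bes}(\mathbb{N},\Phi)$ be bounded. Then there is a subsequence $\Psi$ of $\Phi$ such that $\|\mathsf{R}^{\mathfrak{p}}h\|_\Psi=\|h\|_\Psi$ for $\Psi$-almost every ultrafilter $\mathfrak{p}$ on $\mathbb{N}$.
   Context: A Følner sequence in $\mathbb{N}$ is a sequence $\Phi\colon N\mapsto\Phi_N$ of finite non-empty subsets of $\mathbb{N}$ with $|(\Phi_N+m)\triangle\Phi_N|/|\Phi_N|\to0$ for all $m\in\mathbb{N}$. $\|f\|_\Phi=\big(\limsup_{N\to\infty}\frac{1}{|\Phi_N|}\sum_{n\in\Phi_N}|f(n)|^2\big)^{1/2}$. A trigonometric polynomial is $n\mapsto\sum_{j=1}^Jc_je^{2\pi i\theta_jn}$ ($c_j\in\mathbb{C}$, $\theta_j\in[0,1)$); $\mathsf{Bes}(\mathbb{N},\Phi)$ is the set of functions approximable arbitrarily well in $\|\cdot\|_\Phi$ by trigonometric polynomials. For an ultrafilter $\mathfrak{p}$ and bounded $h$, $(\mathsf{R}^{\mathfrak{p}}h)(n)=\lim_{m\to\mathfrak{p}}h(n+m)$. $\beta\mathbb{N}$ denotes the space of ultrafilters on $\mathbb{N}$ (Stone–Čech compactification), and $\mathcal{M}(\Psi)$ is the set of Radon probability measures on $\beta\mathbb{N}$ that are weak$^*$ accumulation points of $\{\frac{1}{|\Psi_N|}\sum_{n\in\Psi_N}\delta_n\}$, $\delta_n$ the point mass at the principal ultrafilter of $n$. A property holds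 for $\Psi$-almost every ultrafilter if the set of ultrafilters with the property has full measure for every $\mu\in\mathcal{M}(\Psi)$. *)

theory Defs
  imports "HOL-Analysis.Analysis"
begin

definition foelner :: "(nat \<Rightarrow> nat set) \<Rightarrow> bool" where
  "foelner \<Phi> \<longleftrightarrow>
     (\<forall>N. finite (\<Phi> N) \<and> \<Phi> N \<noteq> {}) \<and>
     (\<forall>m::nat. (\<lambda>N. real (card ((((+) m) ` \<Phi> N - \<Phi> N) \<union> (\<Phi> N - ((+) m) ` \<Phi> N)))
                       / real (card (\<Phi> N))) \<longlonglongrightarrow> 0)"

text \<open>The Besicovitch seminorm along \<Phi>: square root of the limsup of the averages of |f|^2.
  (Only used for bounded functions, where the limsup is finite.)\<close>
definition besnorm :: "(nat \<Rightarrow> nat set) \<Rightarrow> (nat \<Rightarrow> complex) \<Rightarrow> real" where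
  "besnorm \<Phi> f = sqrt (real_of_ereal
      (limsup (\<lambda>N. ereal ((1 / real (card (\<Phi> N))) * (\<Sum>n\<in>\<Phi> N. (cmod (f n))\<^sup>2)))))"

definition trig_poly :: "(nat \<Rightarrow> complex) \<Rightarrow> bool" where
  "trig_poly f \<longleftrightarrow> (\<exists>(J::nat) (c::nat \<Rightarrow> complex) (\<theta>::nat \<Rightarrow> real).
      (\<forall>j<J. 0 \<le> \<theta> j \<and> \<theta> j < 1) \<and>
      f = (\<lambda>n. \<Sum>j<J. c j * exp (2 * of_real pi * \<i> * of_real (\<theta> j) * of_nat n)))"

definition Bes :: "(nat \<Rightarrow> nat set) \<Rightarrow> (nat \<Rightarrow> complex) set" where
  "Bes \<Phi> = {h. \<forall>\<epsilon>>0. \<exists>P. trig_poly P \<and> besnorm \<Phi> (\<lambda>n. h n - P n) < \<epsilon>}"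

definition ultrafilter_nat :: "nat filter \<Rightarrow> bool" where
  "ultrafilter_nat F \<longleftrightarrow> F \<noteq> bot \<and>
     (\<forall>A. eventually (\<lambda>x. x \<in> A) F \<or> eventually (\<lambda>x. x \<notin> A) F)"

definition betaN :: "nat filter set" where
  "betaN = {F. ultrafilter_nat F}"

definition beta_basic :: "nat set \<Rightarrow> nat filter set" where
  "beta_basic A = {q \<in> betaN. eventually (\<lambda>x. x \<in> A) q}"

definition beta_open :: "nat filter set \<Rightarrow> bool" where
  "beta_open U \<longleftrightarrow> U \<subseteq> betaN \<and>
     (\<forall>p\<in>U. \<exists>A. p \<in> beta_basic A \<and> beta_basic A \<subseteq> U)"

definition beta_top :: "nat filter topology" where
  "beta_top = topology beta_open"

definition beta_borel :: "nat filter set set" where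
  "beta_borel = sigma_sets betaN {U. beta_open U}"

definition pr_uf :: "nat \<Rightarrow> nat filter" where
  "pr_uf n = principal {n}"

text \<open>Radon probability measures on betaN: Borel probability measures that are
  inner regular by compact sets (for finite measures on a compact Hausdorff space this
  is the usual notion of a Radon measure).\<close>
definition radon_prob_beta :: "nat filter measure \<Rightarrow> bool" where
  "radon_prob_beta \<mu> \<longleftrightarrow> emeasure \<mu> (space \<mu>) = 1 \<and> space \<mu> = betaN \<and> sets \<mu> = beta_borel \<and>
     (\<forall>B\<in>sets \<mu>. emeasure \<mu> B = (SUP K\<in>{K. K \<subseteq> B \<and> compactin beta_top K}. emeasure \<mu> K))"

text \<open>M(\<Psi>): Radon probability measures that are weak-* accumulation points of the
  empirical measures (1/|\<Psi>_N|) \<Sum>_{n\<in>\<Psi>_N} \<delta>_n, i.e. every basic weak-* neighbourhood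
  (given by finitely many continuous real functions and \<epsilon>>0) contains the
  N-th empirical measure for infinitely many N.\<close>
definition accum_measures :: "(nat \<Rightarrow> nat set) \<Rightarrow> nat filter measure set" where
  "accum_measures \<Psi> = {\<mu>. radon_prob_beta \<mu> \<and>
     (\<forall>F \<epsilon> N0. finite F \<and> (\<forall>f\<in>F. continuous_map beta_top euclideanreal f) \<and> \<epsilon> > 0 \<longrightarrow>
        (\<exists>N\<ge>N0. \<forall>f\<in>F. \<bar>(\<integral>p. f p \<partial>\<mu>) -
              (1 / real (card (\<Psi> N))) * (\<Sum>n\<in>\<Psi> N. f (pr_uf n))\<bar> < \<epsilon>))}"

definition Rp :: "nat filter \<Rightarrow> (nat \<Rightarrow> complex) \<Rightarrow> nat \<Rightarrow> complex" where
  "Rp p h n = Lim p (\<lambda>m. h (n + m))"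

end

theory Submission
  imports Defs
begin

text \<open>
  Choose trigonometric polynomials \<open>P\<^sub>N\<close> whose squared distance to \<open>h\<close> along \<open>\<Phi>\<close> is below \<open>4^(-N)\<close>.
  For a trigonometric polynomial the averages of \<open>|P(n + m)|\<^sup>2\<close> over \<open>n \<in> \<Phi>\<^sub>k\<close> become independent
  of \<open>m\<close>, uniformly in \<open>m\<close>, as \<open>k\<close> grows. Hence a sparse subsequence \<open>\<Psi>\<close> makes the \<open>N\<close>-th average both
  nearly shift invariant on \<open>|P\<^sub>N|\<^sup>2\<close> and at most \<open>4^(-N)\<close> on \<open>|h - P\<^sub>N|\<^sup>2\<close>. For \<open>\<mu>\<close> in \<open>M(\<Psi>)\<close> the integral
  over \<open>p\<close> of the average of \<open>|R\<^sup>p h - R\<^sup>p P\<^sub>N|\<^sup>2\<close> over \<open>\<Psi>\<^sub>N\<close> is a limit of double averages of the shifts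
  of \<open>|h - P\<^sub>N|\<^sup>2\<close>, so it is at most \<open>2 * 4^(-N)\<close>. These bounds are summable, so the averages tend to 0 for
  almost every \<open>p\<close>. Pairing the \<open>N\<close>-th average with the \<open>N\<close>-th polynomial in this way replaces a
  pointwise ergodic theorem: for such \<open>p\<close> the averages over \<open>\<Psi>\<^sub>N\<close> of \<open>|R\<^sup>p h|\<^sup>2\<close>, \<open>|R\<^sup>p P\<^sub>N|\<^sup>2\<close>, \<open>|P\<^sub>N|\<^sup>2\<close>
  and \<open>|h|\<^sup>2\<close> pairwise differ by quantities tending to 0.
\<close>

section \<open>The topology of \<open>betaN\<close> and limits along ultrafilters\<close>

lemma beta_basic_Int: "beta_basic A \<inter> beta_basic B = beta_basic (A \<inter> B)"
  by (auto simp: beta_basic_def eventually_conj_iff)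

lemma istopology_beta_open: "istopology beta_open"
  unfolding istopology_def
proof (intro conjI allI impI)
  fix S T assume "beta_open S" "beta_open T"
  then show "beta_open (S \<inter> T)"
    unfolding beta_open_def by (metis IntD1 IntD2 IntI Int_mono beta_basic_Int le_infI1)
next
  fix K assume "\<forall>S\<in>K. beta_open S"
  then show "beta_open (\<Union>K)"
    unfolding beta_open_def by (meson Union_iff Union_least Union_upper subset_trans)
qed

lemma openin_beta_top: "openin beta_top U \<longleftrightarrow> beta_open U"
  by (simp add: beta_top_def istopology_beta_open topology_inverse')

lemma topspace_beta_top: "topspace beta_top = betaN"
proof -
  have "beta_open betaN"
    unfolding beta_open_def beta_basic_def by (auto intro: exI[of _ UNIV])
  then show ?thesis
    by (metis beta_open_def openin_beta_top openin_subset openin_topspace subset_antisym)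
qed

text \<open>Compactness yields a cluster point of \<open>w\<close> along \<open>p\<close>, and the
  ultrafilter dichotomy turns a cluster point into a limit. This gives meaning to
  \<open>Lim\<close>, which is a definite description.\<close>

lemma ultrafilter_tendsto_Lim:
  fixes w :: "nat \<Rightarrow> 'a::heine_borel"
  assumes p: "ultrafilter_nat p" and b: "bounded (range w)"
  shows "(w \<longlongrightarrow> Lim p w) p"
proof -
  have nb: "p \<noteq> bot" using p by (simp add: ultrafilter_nat_def)
  have "compact (closure (range w))" using b by (simp add: compact_closure)
  moreover have "filtermap w p \<noteq> bot" using nb by (simp add: filtermap_bot_iff)
  moreover have "eventually (\<lambda>x. x \<in> closure (range w)) (filtermap w p)"
    by (simp add: eventually_filtermap closure_subset[THEN subsetD])
  ultimately obtain x where x: "inf (nhds x) (filtermap w p) \<noteq> bot"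
    unfolding compact_filter by blast
  have "(w \<longlongrightarrow> x) p"
  proof (rule topological_tendstoI)
    fix S assume S: "open S" "x \<in> S"
    have "\<not> eventually (\<lambda>m. m \<notin> {m. w m \<in> S}) p"
    proof
      assume "eventually (\<lambda>m. m \<notin> {m. w m \<in> S}) p"
      then have "eventually (\<lambda>y. y \<notin> S) (filtermap w p)"
        by (simp add: eventually_filtermap)
      moreover have "eventually (\<lambda>y. y \<in> S) (nhds x)"
        using S by (rule eventually_nhds_in_open)
      ultimately have "eventually (\<lambda>y. False) (inf (nhds x) (filtermap w p))"
        unfolding eventually_inf by blast
      with x show False by (simp add: eventually_False)
    qed
    then show "eventually (\<lambda>m. w m \<in> S) p"
      using conjunct2[OF p[unfolded ultrafilter_nat_def], rule_format, of "{m. w m \<in> S}"] by simp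
  qed
  with nb show ?thesis by (metis tendsto_Lim)
qed

lemma Lim_pr_uf:
  fixes w :: "nat \<Rightarrow> 'a::t2_space"
  shows "Lim (pr_uf n) w = w n"
proof (rule tendsto_Lim)
  show "pr_uf n \<noteq> bot" by (simp add: pr_uf_def principal_eq_bot_iff)
  show "(w \<longlongrightarrow> w n) (pr_uf n)"
    by (rule topological_tendstoI) (simp add: pr_uf_def eventually_principal)
qed

text \<open>By \<open>Lim_pr_uf\<close> this map extends \<open>w\<close> from the principal
  ultrafilters to \<open>betaN\<close>. Its continuity makes it an admissible test function in
  \<open>accum_measures\<close>.\<close>

lemma continuous_map_Lim:
  fixes w :: "nat \<Rightarrow> real"
  assumes b: "bounded (range w)"
  shows "continuous_map beta_top euclideanreal (\<lambda>p. Lim p w)"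
  unfolding continuous_map_def topspace_beta_top openin_beta_top
proof (intro conjI allI impI)
  fix U :: "real set" assume "openin euclideanreal U"
  then have U: "open U" by simp
  show "beta_open {p \<in> betaN. Lim p w \<in> U}"
    unfolding beta_open_def
  proof (intro conjI ballI)
    fix p assume "p \<in> {p \<in> betaN. Lim p w \<in> U}"
    then have p: "p \<in> betaN" "Lim p w \<in> U" by auto
    \<comment> \<open>A closed ball is taken because a limit along \<open>q\<close> inherits only
      closed conditions.\<close>
    obtain e where e: "e > 0" "cball (Lim p w) e \<subseteq> U"
      using U p(2) open_contains_cball by blast
    define A where "A = {m. w m \<in> cball (Lim p w) e}"
    have "eventually (\<lambda>m. m \<in> A) p"
      using tendstoD[OF ultrafilter_tendsto_Lim[OF _ b] e(1), of p] p(1)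
      by (auto simp: A_def betaN_def dist_commute elim!: eventually_mono)
    moreover have "Lim q w \<in> U" if q: "q \<in> beta_basic A" for q
    proof -
      have uq: "ultrafilter_nat q" and ev: "eventually (\<lambda>m. w m \<in> cball (Lim p w) e) q"
        using q by (auto simp: beta_basic_def betaN_def A_def)
      have "Lim q w \<in> cball (Lim p w) e"
        using uq by (intro Lim_in_closed_set[OF closed_cball ev _ ultrafilter_tendsto_Lim[OF uq b]])
          (simp add: ultrafilter_nat_def)
      then show ?thesis using e by blast
    qed
    ultimately show "\<exists>A. p \<in> beta_basic A \<and> beta_basic A \<subseteq> {p \<in> betaN. Lim p w \<in> U}"
      using p(1) by (intro exI[of _ A]) (auto simp: beta_basic_def)
  qed auto
qed auto

lemma borel_measurable_continuous_beta:
  assumes "radon_prob_beta \<mu>" "continuous_map beta_top euclideanreal f"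
  shows "f \<in> borel_measurable \<mu>"
proof (rule borel_measurableI)
  fix S :: "real set" assume "open S"
  then have "beta_open {p \<in> betaN. f p \<in> S}"
    using assms(2) unfolding continuous_map_def topspace_beta_top openin_beta_top by simp
  moreover have "f -` S \<inter> space \<mu> = {p \<in> betaN. f p \<in> S}"
    using assms(1) by (auto simp: radon_prob_beta_def)
  ultimately show "f -` S \<inter> space \<mu> \<in> sets \<mu>"
    using assms(1) by (auto simp: radon_prob_beta_def beta_borel_def)
qed

section \<open>Averages over finite sets\<close>

definition avg :: "nat set \<Rightarrow> (nat \<Rightarrow> 'a::real_normed_vector) \<Rightarrow> 'a" where
  "avg A f = (1 / real (card A)) *\<^sub>R (\<Sum>n\<in>A. f n)"

text \<open>The weak-* condition is tested on the single function
  \<open>\<lambda>p. Lim p w\<close>, whose empirical averages are those of \<open>w\<close>. An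
  eventual bound suffices because the accumulation occurs at arbitrarily large indices.\<close>

lemma integral_Lim_le:
  fixes w :: "nat \<Rightarrow> real"
  assumes \<mu>: "\<mu> \<in> accum_measures \<Psi>" and b: "bounded (range w)"
    and ev: "eventually (\<lambda>N. avg (\<Psi> N) w \<le> C) sequentially"
  shows "(\<integral>p. Lim p w \<partial>\<mu>) \<le> C"
proof (rule field_le_epsilon)
  fix e :: real assume e: "e > 0"
  obtain N0 where N0: "\<And>N. N \<ge> N0 \<Longrightarrow> avg (\<Psi> N) w \<le> C"
    using ev by (auto simp: eventually_sequentially)
  have "\<exists>N\<ge>N0. \<forall>f\<in>{\<lambda>p. Lim p w}. \<bar>(\<integral>p. f p \<partial>\<mu>) -
              (1 / real (card (\<Psi> N))) * (\<Sum>n\<in>\<Psi> N. f (pr_uf n))\<bar> < e"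
    using \<mu> continuous_map_Lim[OF b] e unfolding accum_measures_def by blast
  then show "(\<integral>p. Lim p w \<partial>\<mu>) \<le> C + e"
    using N0 by (fastforce simp: Lim_pr_uf avg_def)
qed

lemma avg_mono: "(\<And>n. n \<in> A \<Longrightarrow> f n \<le> g n) \<Longrightarrow> avg A f \<le> avg A g" for f g :: "nat \<Rightarrow> real"
  by (auto simp: avg_def intro!: mult_left_mono sum_mono divide_right_mono)

lemma avg_nonneg: "(\<And>n. n \<in> A \<Longrightarrow> 0 \<le> f n) \<Longrightarrow> 0 \<le> avg A f" for f :: "nat \<Rightarrow> real"
  by (auto simp: avg_def intro!: sum_nonneg divide_nonneg_nonneg)

lemma avg_const: "finite A \<Longrightarrow> A \<noteq> {} \<Longrightarrow> avg A (\<lambda>n. c) = c"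
  by (simp add: avg_def sum_constant_scaleR)

lemma avg_le_const: "finite A \<Longrightarrow> A \<noteq> {} \<Longrightarrow> (\<And>n. n \<in> A \<Longrightarrow> f n \<le> c) \<Longrightarrow> avg A f \<le> c"
  for f :: "nat \<Rightarrow> real"
  using avg_mono[of A f "\<lambda>n. c"] by (simp add: avg_const)

lemma avg_diff: "avg A (\<lambda>n. f n - g n) = avg A f - avg A g"
  by (simp add: avg_def sum_subtractf algebra_simps)

lemma avg_add: "avg A (\<lambda>n. f n + g n) = avg A f + avg A g"
  by (simp add: avg_def sum.distrib algebra_simps)

lemma avg_sum: "avg A (\<lambda>n. \<Sum>i\<in>I. f i n) = (\<Sum>i\<in>I. avg A (f i))"
  by (simp add: avg_def sum.swap[of _ I A] scaleR_sum_right)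

lemma avg_cmult: "avg A (\<lambda>n. c * f n) = c * avg A f" for c :: "'a::real_normed_algebra"
  by (simp add: avg_def sum_distrib_left)

lemma avg_swap: "avg A (\<lambda>m. avg B (\<lambda>n. f n m)) = avg B (\<lambda>n. avg A (f n))"
  by (simp add: avg_def scaleR_sum_right[symmetric] sum.swap[of _ B A] mult.commute)

lemma avg_of_real: "avg A (\<lambda>n. of_real (f n)) = (of_real (avg A f) :: 'a::real_normed_algebra_1)"
  by (simp add: avg_def scaleR_conv_of_real flip: of_real_sum of_real_mult)

lemma abs_avg_le: "\<bar>avg A f\<bar> \<le> avg A (\<lambda>n. \<bar>f n\<bar>)" for f :: "nat \<Rightarrow> real"
  by (simp add: avg_def abs_mult divide_right_mono sum_abs)

lemma tendsto_avg:
  assumes "\<And>n. n \<in> A \<Longrightarrow> ((\<lambda>m. f m n) \<longlongrightarrow> g n) F"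
  shows "((\<lambda>m. avg A (f m)) \<longlongrightarrow> avg A g) F"
  unfolding avg_def by (intro tendsto_intros assms)

text \<open>Cauchy-Schwarz against the constant 1.\<close>

lemma avg_le_sqrt_avg_square:
  assumes "finite A" "A \<noteq> {}"
  shows "avg A f \<le> sqrt (avg A (\<lambda>n. (f n)\<^sup>2))"
proof (rule real_le_rsqrt)
  have c: "real (card A) > 0" using assms by (simp add: card_gt_0_iff)
  have "(\<Sum>n\<in>A. f n)\<^sup>2 \<le> (\<Sum>n\<in>A. (f n)\<^sup>2) * real (card A)"
    using sum_squared_le_sum_of_squares[of f A] assms by simp
  then show "(avg A f)\<^sup>2 \<le> avg A (\<lambda>n. (f n)\<^sup>2)"
    using c by (simp add: avg_def field_simps power2_eq_square)
qed

text \<open>Factor the difference of squares pointwise and apply Cauchy-Schwarz to the linear term.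
  The bound involves only \<open>M\<close> and the mean square distance, so it stays uniform when
  \<open>y\<close> runs through polynomials whose sup norms may grow.\<close>

lemma avg_norm_square_perturb:
  fixes x y :: "nat \<Rightarrow> 'a::real_normed_vector"
  assumes A: "finite A" "A \<noteq> {}" and M: "\<And>n. n \<in> A \<Longrightarrow> norm (x n) \<le> M"
  shows "\<bar>avg A (\<lambda>n. (norm (x n))\<^sup>2) - avg A (\<lambda>n. (norm (y n))\<^sup>2)\<bar>
    \<le> 2 * M * sqrt (avg A (\<lambda>n. (norm (x n - y n))\<^sup>2)) + avg A (\<lambda>n. (norm (x n - y n))\<^sup>2)"
proof -
  have M0: "M \<ge> 0" using A M norm_ge_zero order_trans by blast
  have pt: "\<bar>(norm (x n))\<^sup>2 - (norm (y n))\<^sup>2\<bar> \<le> 2 * M * norm (x n - y n) + (norm (x n - y n))\<^sup>2"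
    if n: "n \<in> A" for n
  proof -
    define d where "d = norm (x n - y n)"
    have d: "\<bar>norm (x n) - norm (y n)\<bar> \<le> d" unfolding d_def by (rule norm_triangle_ineq3)
    have "\<bar>(norm (x n))\<^sup>2 - (norm (y n))\<^sup>2\<bar> = \<bar>norm (x n) - norm (y n)\<bar> * (norm (x n) + norm (y n))"
      by (simp add: power2_eq_square square_diff_square_factored abs_mult)
    also have "\<dots> \<le> d * (2 * M + d)"
      using d M[OF n] by (intro mult_mono) (auto simp: d_def)
    finally show ?thesis by (simp add: d_def algebra_simps power2_eq_square)
  qed
  have "\<bar>avg A (\<lambda>n. (norm (x n))\<^sup>2 - (norm (y n))\<^sup>2)\<bar>
    \<le> avg A (\<lambda>n. 2 * M * norm (x n - y n) + (norm (x n - y n))\<^sup>2)"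
    by (rule order_trans[OF abs_avg_le avg_mono]) (rule pt)
  also have "\<dots> = 2 * M * avg A (\<lambda>n. norm (x n - y n)) + avg A (\<lambda>n. (norm (x n - y n))\<^sup>2)"
    by (simp only: avg_add avg_cmult)
  also have "\<dots> \<le> 2 * M * sqrt (avg A (\<lambda>n. (norm (x n - y n))\<^sup>2)) + avg A (\<lambda>n. (norm (x n - y n))\<^sup>2)"
    using M0 avg_le_sqrt_avg_square[OF A, of "\<lambda>n. norm (x n - y n)"] by (intro add_right_mono mult_left_mono) auto
  finally show ?thesis by (simp add: avg_diff)
qed

section \<open>Shift invariance of averages along a Foelner sequence\<close>

lemma foelner_avg_shift:
  fixes g :: "nat \<Rightarrow> 'a::real_normed_vector"
  assumes F: "foelner \<Phi>" and C: "\<And>n. norm (g n) \<le> C"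
  shows "(\<lambda>N. avg (\<Phi> N) (\<lambda>n. g (n + m)) - avg (\<Phi> N) g) \<longlonglongrightarrow> 0"
proof (rule Lim_null_comparison)
  define D where "D N = ((+) m ` \<Phi> N - \<Phi> N) \<union> (\<Phi> N - (+) m ` \<Phi> N)" for N
  show "(\<lambda>N. C * (real (card (D N)) / real (card (\<Phi> N)))) \<longlonglongrightarrow> 0"
    unfolding D_def by (rule tendsto_mult_right_zero) (use F in \<open>unfold foelner_def, blast\<close>)
  have "norm (avg (\<Phi> N) (\<lambda>n. g (n + m)) - avg (\<Phi> N) g) \<le> C * (real (card (D N)) / real (card (\<Phi> N)))" for N
  proof -
    let ?S = "(+) m ` \<Phi> N" and ?A = "\<Phi> N"
    have fin: "finite ?A" using F by (simp add: foelner_def)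
    have "(\<Sum>n\<in>?A. g (n + m)) = sum g ?S"
      by (subst sum.reindex) (auto simp: add.commute)
    also have "\<dots> = sum g (?S - ?A) + sum g (?S \<inter> ?A)"
      using fin by (metis add.commute finite_imageI sum.Int_Diff)
    finally have 1: "(\<Sum>n\<in>?A. g (n + m)) = sum g (?S - ?A) + sum g (?S \<inter> ?A)" .
    have 2: "sum g ?A = sum g (?A - ?S) + sum g (?S \<inter> ?A)"
      using fin by (metis add.commute sum.Int_Diff inf_commute)
    \<comment> \<open>The terms over \<open>?S \<inter> ?A\<close> cancel, so only the symmetric
      difference \<open>D N\<close> contributes.\<close>
    have "norm ((\<Sum>n\<in>?A. g (n + m)) - sum g ?A) = norm (sum g (?S - ?A) - sum g (?A - ?S))"
      using 1 2 by simp
    also have "\<dots> \<le> norm (sum g (?S - ?A)) + norm (sum g (?A - ?S))" by (rule norm_triangle_ineq4)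
    also have "\<dots> \<le> real (card (?S - ?A)) * C + real (card (?A - ?S)) * C"
      using C by (intro add_mono sum_norm_bound) auto
    also have "\<dots> = C * real (card (D N))"
      unfolding D_def using fin by (subst card_Un_disjoint) (auto simp: algebra_simps)
    finally have "norm ((\<Sum>n\<in>?A. g (n + m)) - sum g ?A) \<le> C * real (card (D N))" .
    then show ?thesis
      unfolding avg_def scaleR_diff_right[symmetric] norm_scaleR
      by (simp add: divide_right_mono)
  qed
  then show "\<forall>\<^sub>F N in sequentially. norm (avg (\<Phi> N) (\<lambda>n. g (n + m)) - avg (\<Phi> N) g)
      \<le> C * (real (card (D N)) / real (card (\<Phi> N)))" by simp
qed

text \<open>The gain over \<open>foelner_avg_shift\<close> is a rate \<open>D\<close> common to all
  \<open>m\<close>. A shift multiplies the average by the unimodular \<open>y ^ m\<close>; for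
  \<open>y \<noteq> 1\<close> the shift by 1 alone forces the average to 0, and twice its modulus
  bounds every shift error.\<close>

lemma foelner_avg_power_shift:
  fixes y :: complex
  assumes F: "foelner \<Phi>" and y: "cmod y = 1"
  shows "\<exists>D. D \<longlonglongrightarrow> 0 \<and> (\<forall>N m. cmod (avg (\<Phi> N) (\<lambda>n. y ^ (n + m)) - avg (\<Phi> N) (\<lambda>n. y ^ n)) \<le> D N)"
proof (cases "y = 1")
  case True
  then show ?thesis by (intro exI[of _ "\<lambda>_. 0"]) simp
next
  case False
  have eq: "avg (\<Phi> N) (\<lambda>n. y ^ (n + m)) = y ^ m * avg (\<Phi> N) (\<lambda>n. y ^ n)" for N m
    by (simp add: power_add mult.commute[of _ "y ^ m"] avg_cmult)
  have "(\<lambda>N. avg (\<Phi> N) (\<lambda>n. y ^ (n + 1)) - avg (\<Phi> N) (\<lambda>n. y ^ n)) \<longlonglongrightarrow> 0"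
    using y by (intro foelner_avg_shift[OF F, where C = 1]) (simp add: norm_power)
  then have "(\<lambda>N. (y - 1) * avg (\<Phi> N) (\<lambda>n. y ^ n)) \<longlonglongrightarrow> 0"
    unfolding eq by (simp add: algebra_simps)
  from tendsto_mult_left[OF this, of "1 / (y - 1)"]
  have "(\<lambda>N. avg (\<Phi> N) (\<lambda>n. y ^ n)) \<longlonglongrightarrow> 0"
    using False by simp
  then have "(\<lambda>N. 2 * cmod (avg (\<Phi> N) (\<lambda>n. y ^ n))) \<longlonglongrightarrow> 0"
    by (intro tendsto_mult_right_zero tendsto_norm_zero)
  moreover have "cmod (avg (\<Phi> N) (\<lambda>n. y ^ (n + m)) - avg (\<Phi> N) (\<lambda>n. y ^ n))
      \<le> 2 * cmod (avg (\<Phi> N) (\<lambda>n. y ^ n))" for N m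
    using norm_triangle_ineq4[of "y ^ m * avg (\<Phi> N) (\<lambda>n. y ^ n)" "avg (\<Phi> N) (\<lambda>n. y ^ n)"]
    unfolding eq by (simp add: norm_mult norm_power y)
  ultimately show ?thesis by blast
qed

text \<open>With unimodular bases in place of angles, products of characters become powers of
  \<open>z i * cnj (z j)\<close>.\<close>

lemma trig_polyE:
  assumes "trig_poly P"
  obtains J :: nat and c z where "\<And>j. cmod (z j) = 1" "P = (\<lambda>n. \<Sum>j<J. c j * z j ^ n)"
proof -
  obtain J :: nat and c and \<theta> :: "nat \<Rightarrow> real" where P: "P = (\<lambda>n. \<Sum>j<J. c j * exp (2 * of_real pi * \<i> * of_real (\<theta> j) * of_nat n))"
    using assms unfolding trig_poly_def by blast
  show ?thesis
  proof (rule that)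
    show "cmod (exp (2 * of_real pi * \<i> * of_real (\<theta> j))) = 1" for j by (simp add: norm_exp_eq_Re)
    show "P = (\<lambda>n. \<Sum>j<J. c j * exp (2 * of_real pi * \<i> * of_real (\<theta> j)) ^ n)"
      unfolding P by (simp add: exp_of_nat2_mult)
  qed
qed

lemma trig_poly_bounded:
  assumes "trig_poly P"
  obtains C where "\<And>n. cmod (P n) \<le> C"
proof -
  obtain J :: nat and c z where z: "\<And>j. cmod (z j) = 1" and P: "P = (\<lambda>n. \<Sum>j<J. c j * z j ^ n)"
    using trig_polyE[OF assms] by blast
  have "cmod (P n) \<le> (\<Sum>j<J. cmod (c j))" for n
    unfolding P by (rule order_trans[OF norm_sum]) (simp add: norm_mult norm_power z)
  with that show ?thesis by blast
qed

text \<open>The squared modulus of \<open>P\<close> is again a finite combination of characters, so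
  finitely many rates from \<open>foelner_avg_power_shift\<close> add up to one that does not depend
  on \<open>m\<close>.\<close>

lemma foelner_trig_poly_shift:
  assumes F: "foelner \<Phi>" and "trig_poly P" and e: "e > 0"
  shows "\<forall>\<^sub>F N in sequentially. \<forall>m.
    \<bar>avg (\<Phi> N) (\<lambda>n. (cmod (P (n + m)))\<^sup>2) - avg (\<Phi> N) (\<lambda>n. (cmod (P n))\<^sup>2)\<bar> < e"
proof -
  obtain J :: nat and c z where z: "\<And>j. cmod (z j) = 1" and P: "P = (\<lambda>n. \<Sum>j<J. c j * z j ^ n)"
    using trig_polyE[OF assms(2)] by blast
  define y where "y i j = z i * cnj (z j)" for i j
  define b where "b i j = c i * cnj (c j)" for i j
  have "cmod (y i j) = 1" for i j by (simp add: y_def norm_mult z)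
  from foelner_avg_power_shift[OF F this] obtain D where
    D0: "\<And>i j. D i j \<longlonglongrightarrow> 0" and
    D: "\<And>i j N m. cmod (avg (\<Phi> N) (\<lambda>n. y i j ^ (n + m)) - avg (\<Phi> N) (\<lambda>n. y i j ^ n)) \<le> D i j N"
    by metis
  have sq: "of_real ((cmod (P n))\<^sup>2) = (\<Sum>i<J. \<Sum>j<J. b i j * y i j ^ n)" for n
    unfolding complex_norm_square P b_def y_def
    by (simp add: sum_product power_mult_distrib algebra_simps)
  have "\<bar>avg (\<Phi> N) (\<lambda>n. (cmod (P (n + m)))\<^sup>2) - avg (\<Phi> N) (\<lambda>n. (cmod (P n))\<^sup>2)\<bar>
      \<le> (\<Sum>i<J. \<Sum>j<J. cmod (b i j) * D i j N)" (is "?l \<le> _") for N m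
  proof -
    have "?l = cmod (of_real (avg (\<Phi> N) (\<lambda>n. (cmod (P (n + m)))\<^sup>2)) - of_real (avg (\<Phi> N) (\<lambda>n. (cmod (P n))\<^sup>2)))"
      by (metis norm_of_real of_real_diff)
    also have "\<dots> = cmod (\<Sum>i<J. \<Sum>j<J. b i j * (avg (\<Phi> N) (\<lambda>n. y i j ^ (n + m)) - avg (\<Phi> N) (\<lambda>n. y i j ^ n)))"
      unfolding avg_of_real[symmetric] sq
      by (simp only: avg_sum avg_cmult sum_subtractf right_diff_distrib)
    also have "\<dots> \<le> (\<Sum>i<J. \<Sum>j<J. cmod (b i j) * D i j N)"
      by (intro sum_norm_le order_trans[OF norm_sum] sum_mono) (simp add: norm_mult mult_left_mono D)
    finally show ?thesis .
  qed
  moreover have "(\<lambda>N. \<Sum>i<J. \<Sum>j<J. cmod (b i j) * D i j N) \<longlonglongrightarrow> 0"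
    by (intro tendsto_null_sum tendsto_mult_right_zero D0)
  then have "\<forall>\<^sub>F N in sequentially. (\<Sum>i<J. \<Sum>j<J. cmod (b i j) * D i j N) < e"
    using e by (rule order_tendstoD)
  ultimately show ?thesis
    by (auto elim!: eventually_mono intro: le_less_trans)
qed

section \<open>The Besicovitch seminorm as a limsup of averages\<close>

lemma besnorm_avg: "besnorm \<Phi> f = sqrt (real_of_ereal (limsup (\<lambda>N. ereal (avg (\<Phi> N) (\<lambda>n. (cmod (f n))\<^sup>2)))))"
  by (simp add: besnorm_def avg_def)

text \<open>Boundedness puts the limsup between 0 and \<open>C\<^sup>2\<close>. This excludes the
  infinite values, which \<open>real_of_ereal\<close> would send to 0.\<close>

lemma besnorm_less_eventually:
  assumes A: "\<And>N. finite (\<Phi> N)" "\<And>N. \<Phi> N \<noteq> {}" and C: "\<And>n. cmod (f n) \<le> C"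
    and less: "besnorm \<Phi> f < e"
  shows "\<forall>\<^sub>F N in sequentially. avg (\<Phi> N) (\<lambda>n. (cmod (f n))\<^sup>2) < e\<^sup>2"
proof -
  define L where "L = limsup (\<lambda>N. ereal (avg (\<Phi> N) (\<lambda>n. (cmod (f n))\<^sup>2)))"
  have "L \<le> ereal (C\<^sup>2)"
    unfolding L_def using C
    by (intro Limsup_bounded always_eventually allI) (auto intro!: avg_le_const A power_mono)
  moreover have "0 \<le> L"
    unfolding L_def by (intro le_Limsup always_eventually allI) (auto intro!: avg_nonneg)
  ultimately obtain l where l: "L = ereal l" "l \<ge> 0"
    by (cases L) auto
  have "sqrt l < e" using less l by (simp add: besnorm_avg L_def)
  then have "l < e\<^sup>2" using l
    by (metis abs_ge_self order_less_le_trans real_sqrt_abs real_sqrt_less_iff)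
  then have "L < ereal (e\<^sup>2)" by (simp add: l)
  then show ?thesis unfolding L_def by (auto dest!: Limsup_lessD)
qed

lemma besnorm_cong_limit:
  assumes "(\<lambda>N. avg (\<Phi> N) (\<lambda>n. (cmod (f n))\<^sup>2) - avg (\<Phi> N) (\<lambda>n. (cmod (g n))\<^sup>2)) \<longlonglongrightarrow> 0"
  shows "besnorm \<Phi> f = besnorm \<Phi> g"
proof -
  define d where "d N = avg (\<Phi> N) (\<lambda>n. (cmod (f n))\<^sup>2) - avg (\<Phi> N) (\<lambda>n. (cmod (g n))\<^sup>2)" for N
  have "(\<lambda>N. ereal (d N)) \<longlonglongrightarrow> ereal 0"
    using assms unfolding d_def by (rule tendsto_ereal)
  from ereal_limsup_lim_add[OF this, of "\<lambda>N. ereal (avg (\<Phi> N) (\<lambda>n. (cmod (g n))\<^sup>2))"]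
  show ?thesis by (simp add: besnorm_avg d_def zero_ereal_def[symmetric])
qed

section \<open>Diagonal choice, almost everywhere convergence and double averages\<close>

lemma strict_mono_diagonal:
  assumes "\<And>N. \<forall>\<^sub>F k in sequentially. Q N k"
  shows "\<exists>\<sigma>::nat \<Rightarrow> nat. strict_mono \<sigma> \<and> (\<forall>N. Q N (\<sigma> N))"
proof -
  have "\<exists>\<sigma>. \<forall>N. Q N (\<sigma> N) \<and> \<sigma> N < \<sigma> (Suc N)"
  proof (rule dependent_nat_choice)
    show "\<exists>k. Q 0 k"
      using assms[of 0] eventually_happens by fastforce
    show "\<exists>l. Q (Suc N) l \<and> k < l" for k N
      using eventually_happens[OF eventually_conj[OF assms[of "Suc N"] eventually_gt_at_top[of k]]] by auto
  qed
  then show ?thesis by (auto simp: strict_mono_Suc_iff)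
qed

text \<open>The sum of the \<open>f N\<close> has finite integral, hence is finite almost
  everywhere, and the terms of a convergent series tend to 0.\<close>

lemma AE_tendsto_0_of_summable_integral:
  fixes f :: "nat \<Rightarrow> 'a \<Rightarrow> real"
  assumes i: "\<And>N. integrable M (f N)" and nn: "\<And>N. AE x in M. 0 \<le> f N x"
    and le: "\<And>N. integral\<^sup>L M (f N) \<le> a N" and a: "summable a"
  shows "AE x in M. (\<lambda>N. f N x) \<longlonglongrightarrow> 0"
proof -
  have [measurable]: "f N \<in> borel_measurable M" for N using i by auto
  have "integral\<^sup>L M (f N) \<ge> 0" for N using nn by (rule integral_nonneg_AE)
  then have a0: "a N \<ge> 0" for N using le order_trans by blast
  have "(\<integral>\<^sup>+x. (\<Sum>N. ennreal (f N x)) \<partial>M) = (\<Sum>N. \<integral>\<^sup>+x. ennreal (f N x) \<partial>M)"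
    by (rule nn_integral_suminf) simp
  also have "\<dots> \<le> (\<Sum>N. ennreal (a N))"
    using nn_integral_eq_integral[OF i nn] le by (intro suminf_le) (auto intro: ennreal_leI)
  also have "\<dots> = ennreal (suminf a)" using a a0 by (intro suminf_ennreal2) auto
  finally have "(\<integral>\<^sup>+x. (\<Sum>N. ennreal (f N x)) \<partial>M) \<noteq> \<infinity>"
    by (auto simp: top_unique)
  then have "AE x in M. (\<Sum>N. ennreal (f N x)) \<noteq> \<infinity>"
    by (intro nn_integral_PInf_AE) auto
  moreover have "AE x in M. \<forall>N. 0 \<le> f N x" using nn by (simp add: AE_all_countable)
  ultimately show ?thesis
  proof eventually_elim
    case (elim x)
    then have "summable (\<lambda>N. f N x)" by (intro summable_suminf_not_top) auto
    then show ?case by (rule summable_LIMSEQ_zero)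
  qed
qed

lemma tendsto_Rp:
  assumes "ultrafilter_nat p" "\<And>n. cmod (f n) \<le> C"
  shows "((\<lambda>m. f (n + m)) \<longlongrightarrow> Rp p f n) p"
  unfolding Rp_def using assms
  by (intro ultrafilter_tendsto_Lim) (auto intro: boundedI)

text \<open>After the averages are swapped, the outer one runs over the fixed finite set
  \<open>B\<close>, so finitely many Foelner shifts are controlled at once. The factor 2 absorbs a
  shift error of at most \<open>a\<close>.\<close>

lemma eventually_avg_shifted_avg_le:
  fixes u :: "nat \<Rightarrow> real"
  assumes F: "foelner \<Phi>" and \<sigma>: "strict_mono \<sigma>" and C: "\<And>n. \<bar>u n\<bar> \<le> C" and B: "finite B" "B \<noteq> {}"
    and ev: "\<forall>\<^sub>F k in sequentially. avg (\<Phi> k) u < a" and a: "a > 0"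
  shows "\<forall>\<^sub>F k in sequentially. avg ((\<Phi> \<circ> \<sigma>) k) (\<lambda>m. avg B (\<lambda>n. u (n + m))) \<le> 2 * a"
proof -
  have "\<forall>\<^sub>F k in sequentially. avg (\<Phi> k) (\<lambda>m. u (n + m)) \<le> 2 * a" for n
  proof -
    have "(\<lambda>k. avg (\<Phi> k) (\<lambda>m. u (m + n)) - avg (\<Phi> k) u) \<longlonglongrightarrow> 0"
      using C by (intro foelner_avg_shift[OF F, of _ C]) simp
    then have "\<forall>\<^sub>F k in sequentially. avg (\<Phi> k) (\<lambda>m. u (m + n)) - avg (\<Phi> k) u < a"
      using a by (rule order_tendstoD)
    with ev show ?thesis by eventually_elim (simp add: add.commute)
  qed
  then have "\<forall>\<^sub>F k in sequentially. \<forall>n\<in>B. avg (\<Phi> k) (\<lambda>m. u (n + m)) \<le> 2 * a"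
    using B by (intro eventually_ball_finite) auto
  then have "\<forall>\<^sub>F k in sequentially. avg (\<Phi> k) (\<lambda>m. avg B (\<lambda>n. u (n + m))) \<le> 2 * a"
    by eventually_elim (subst avg_swap, rule avg_le_const[OF B], blast)
  then show ?thesis
    unfolding comp_apply by (rule eventually_compose_filterlim[OF _ filterlim_subseq[OF \<sigma>]])
qed

section \<open>Transfer of the seminorm from \<open>h\<close> to almost every
  \<open>Rp p h\<close>\<close>

theorem theorem4p15:
  fixes \<Phi> :: "nat \<Rightarrow> nat set" and h :: "nat \<Rightarrow> complex"
  assumes "foelner \<Phi>" and "h \<in> Bes \<Phi>" and "bounded (range h)"
  shows "\<exists>\<sigma>::nat \<Rightarrow> nat. strict_mono \<sigma> \<and>
    (\<forall>\<mu>\<in>accum_measures (\<Phi> \<circ> \<sigma>).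
       \<exists>B\<in>sets \<mu>. B \<subseteq> {p \<in> betaN. besnorm (\<Phi> \<circ> \<sigma>) (Rp p h) = besnorm (\<Phi> \<circ> \<sigma>) h}
                 \<and> emeasure \<mu> B = 1)"
proof -
  have A: "finite (\<Phi> N)" "\<Phi> N \<noteq> {}" for N using assms(1) by (auto simp: foelner_def)
  obtain M where M: "\<And>n. cmod (h n) \<le> M" using assms(3) by (auto simp: bounded_iff)
  have "\<exists>P. trig_poly P \<and> besnorm \<Phi> (\<lambda>n. h n - P n) < (1/2) ^ N" for N
    using assms(2) by (simp add: Bes_def)
  then obtain P where P: "\<And>N. trig_poly (P N)" "\<And>N. besnorm \<Phi> (\<lambda>n. h n - P N n) < (1/2) ^ N"
    by metis
  have "\<exists>C. \<forall>n. cmod (P N n) \<le> C" for N using trig_poly_bounded[OF P(1)] by metis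
  then obtain K where K: "\<And>N n. cmod (P N n) \<le> K N" by metis
  \<comment> \<open>The square appears because \<open>besnorm\<close> is a root of mean squares.
    Summability of these numbers is what the almost everywhere argument uses; the shift tolerance
    \<open>1 / real (Suc N)\<close> below only has to tend to 0.\<close>
  define \<epsilon> :: "nat \<Rightarrow> real" where "\<epsilon> N = ((1/2) ^ N)\<^sup>2" for N
  have \<epsilon>: "\<epsilon> N > 0" for N by (simp add: \<epsilon>_def)
  have \<epsilon>_eq: "\<epsilon> = (\<lambda>N. (1/4) ^ N)"
    by (simp add: \<epsilon>_def fun_eq_iff power2_eq_square power_mult_distrib[symmetric])
  have C: "cmod (h n - P N n) \<le> M + K N" for N n
    using norm_triangle_ineq4[of "h n" "P N n"] M[of n] K[of N n] by linarith
  have close: "\<forall>\<^sub>F k in sequentially. avg (\<Phi> k) (\<lambda>n. (cmod (h n - P N n))\<^sup>2) < \<epsilon> N" for N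
    unfolding \<epsilon>_def by (rule besnorm_less_eventually[OF A C P(2)])
  have "\<exists>\<sigma>::nat \<Rightarrow> nat. strict_mono \<sigma> \<and> (\<forall>N.
      (\<forall>m. \<bar>avg (\<Phi> (\<sigma> N)) (\<lambda>n. (cmod (P N (n + m)))\<^sup>2) - avg (\<Phi> (\<sigma> N)) (\<lambda>n. (cmod (P N n))\<^sup>2)\<bar>
         < 1 / real (Suc N)) \<and>
      avg (\<Phi> (\<sigma> N)) (\<lambda>n. (cmod (h n - P N n))\<^sup>2) < \<epsilon> N)"
    by (intro strict_mono_diagonal eventually_conj close foelner_trig_poly_shift assms P) simp
  then obtain \<sigma> where \<sigma>: "strict_mono \<sigma>"
    and shift: "\<And>N m. \<bar>avg (\<Phi> (\<sigma> N)) (\<lambda>n. (cmod (P N (n + m)))\<^sup>2) - avg (\<Phi> (\<sigma> N)) (\<lambda>n. (cmod (P N n))\<^sup>2)\<bar>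
         < 1 / real (Suc N)"
    and close_\<sigma>: "\<And>N. avg (\<Phi> (\<sigma> N)) (\<lambda>n. (cmod (h n - P N n))\<^sup>2) < \<epsilon> N"
    by blast
  define \<Psi> where "\<Psi> = \<Phi> \<circ> \<sigma>"
  have A\<Psi>: "finite (\<Psi> N)" "\<Psi> N \<noteq> {}" for N using A by (auto simp: \<Psi>_def)
  \<comment> \<open>The limit of \<open>w N\<close> along \<open>p\<close> is the mean square over
    \<open>\<Psi> N\<close> of \<open>Rp p h - Rp p (P N)\<close>.\<close>
  define w where "w N m = avg (\<Psi> N) (\<lambda>n. (cmod (h (n + m) - P N (n + m)))\<^sup>2)" for N m
  have w0: "0 \<le> w N m" for N m unfolding w_def by (rule avg_nonneg) simp
  have wC: "w N m \<le> (M + K N)\<^sup>2" for N m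
    unfolding w_def using C by (intro avg_le_const A\<Psi> power_mono) auto
  have wb: "bounded (range (w N))" for N
    using w0 wC by (intro boundedI[of _ "(M + K N)\<^sup>2"]) auto
  have Lim_w: "0 \<le> Lim p (w N)" "Lim p (w N) \<le> (M + K N)\<^sup>2" if "p \<in> betaN" for p N
  proof -
    have u: "ultrafilter_nat p" "p \<noteq> bot" using that by (auto simp: betaN_def ultrafilter_nat_def)
    show "0 \<le> Lim p (w N)"
      using w0 by (intro tendsto_lowerbound[OF ultrafilter_tendsto_Lim[OF u(1) wb] _ u(2)]) simp
    show "Lim p (w N) \<le> (M + K N)\<^sup>2"
      using wC by (intro tendsto_upperbound[OF ultrafilter_tendsto_Lim[OF u(1) wb] _ u(2)]) simp
  qed
  \<comment> \<open>This part is deterministic: convergence at one \<open>p\<close> already gives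
    equality of the seminorms there.\<close>
  have eq: "besnorm \<Psi> (Rp p h) = besnorm \<Psi> h" if p: "p \<in> betaN" and lim: "(\<lambda>N. Lim p (w N)) \<longlonglongrightarrow> 0" for p
  proof -
    have u: "ultrafilter_nat p" "p \<noteq> bot" using p by (auto simp: betaN_def ultrafilter_nat_def)
    note Rh = tendsto_Rp[OF u(1) M] and RP = tendsto_Rp[OF u(1) K]
    have Mh: "cmod (Rp p h n) \<le> M" for n
      using M by (intro tendsto_upperbound[OF tendsto_norm[OF Rh] _ u(2)]) simp
    let ?sq = "\<lambda>N f. avg (\<Psi> N) (\<lambda>n. (cmod (f n))\<^sup>2)"
    have "Lim p (w N) = ?sq N (\<lambda>n. Rp p h n - Rp p (P N) n)" for N
      unfolding w_def by (intro tendsto_Lim[OF u(2)] tendsto_avg tendsto_intros Rh RP)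
    then have 1: "(\<lambda>N. ?sq N (\<lambda>n. Rp p h n - Rp p (P N) n)) \<longlonglongrightarrow> 0" using lim by simp
    have 2: "(\<lambda>N. ?sq N (\<lambda>n. h n - P N n)) \<longlonglongrightarrow> 0"
    proof (rule tendsto_sandwich[OF _ _ tendsto_const])
      show "\<epsilon> \<longlonglongrightarrow> 0" unfolding \<epsilon>_eq by (intro LIMSEQ_power_zero) simp
    qed (use close_\<sigma> in \<open>auto simp: \<Psi>_def less_imp_le intro!: always_eventually avg_nonneg\<close>)
    \<comment> \<open>Used with \<open>x\<close> as \<open>Rp p h\<close> and as \<open>h\<close>;
      the comparison function \<open>y N\<close> varies with the averaging set.\<close>
    have perturb: "(\<lambda>N. ?sq N x - ?sq N (y N)) \<longlonglongrightarrow> 0"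
      if x: "\<And>n. cmod (x n) \<le> M" and xy: "(\<lambda>N. ?sq N (\<lambda>n. x n - y N n)) \<longlonglongrightarrow> 0" for x y
    proof (rule Lim_null_comparison)
      show "\<forall>\<^sub>F N in sequentially. norm (?sq N x - ?sq N (y N))
          \<le> 2 * M * sqrt (?sq N (\<lambda>n. x n - y N n)) + ?sq N (\<lambda>n. x n - y N n)"
        using avg_norm_square_perturb[OF A\<Psi> x] by simp
      show "(\<lambda>N. 2 * M * sqrt (?sq N (\<lambda>n. x n - y N n)) + ?sq N (\<lambda>n. x n - y N n)) \<longlonglongrightarrow> 0"
        using tendsto_add[OF tendsto_mult_left[OF tendsto_real_sqrt[OF xy], of "2 * M"] xy] by simp
    qed
    \<comment> \<open>The bound in \<open>shift\<close> is uniform in \<open>m\<close>, so it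
      survives the limit along \<open>p\<close>, with a weak inequality in place of the strict
      one.\<close>
    have 3: "(\<lambda>N. ?sq N (Rp p (P N)) - ?sq N (P N)) \<longlonglongrightarrow> 0"
    proof (rule Lim_null_comparison[OF always_eventually LIMSEQ_inverse_real_of_nat], rule allI)
      fix N
      have "((\<lambda>m. \<bar>avg (\<Psi> N) (\<lambda>n. (cmod (P N (n + m)))\<^sup>2) - ?sq N (P N)\<bar>)
          \<longlongrightarrow> \<bar>?sq N (Rp p (P N)) - ?sq N (P N)\<bar>) p"
        by (intro tendsto_avg tendsto_intros RP)
      then show "norm (?sq N (Rp p (P N)) - ?sq N (P N)) \<le> inverse (real (Suc N))"
        unfolding real_norm_def
        by (rule tendsto_upperbound[OF _ always_eventually u(2)])
          (use shift[of N] in \<open>auto simp: \<Psi>_def inverse_eq_divide less_imp_le\<close>)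
    qed
    \<comment> \<open>Telescoping through \<open>Rp p (P N)\<close> and \<open>P N\<close>.\<close>
    have "(\<lambda>N. ?sq N (Rp p h) - ?sq N h) \<longlonglongrightarrow> 0"
      using tendsto_diff[OF tendsto_add[OF perturb[OF Mh 1] 3] perturb[OF M 2]] by simp
    then show ?thesis by (rule besnorm_cong_limit)
  qed
  have "\<exists>B\<in>sets \<mu>. B \<subseteq> {p \<in> betaN. besnorm \<Psi> (Rp p h) = besnorm \<Psi> h} \<and> emeasure \<mu> B = 1"
    if \<mu>: "\<mu> \<in> accum_measures \<Psi>" for \<mu>
  proof -
    have r: "radon_prob_beta \<mu>" using \<mu> by (simp add: accum_measures_def)
    then have sp: "space \<mu> = betaN" and em: "emeasure \<mu> (space \<mu>) = 1" by (auto simp: radon_prob_beta_def)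
    interpret finite_measure \<mu> by standard (simp add: em)
    have "AE p in \<mu>. (\<lambda>N. Lim p (w N)) \<longlonglongrightarrow> 0"
    proof (rule AE_tendsto_0_of_summable_integral)
      show "integrable \<mu> (\<lambda>p. Lim p (w N))" for N
        using Lim_w sp
        by (intro integrable_const_bound[of _ "(M + K N)\<^sup>2"]
            borel_measurable_continuous_beta[OF r continuous_map_Lim[OF wb]]) auto
      show "AE p in \<mu>. 0 \<le> Lim p (w N)" for N using Lim_w sp by auto
      show "(\<integral>p. Lim p (w N) \<partial>\<mu>) \<le> 2 * \<epsilon> N" for N
      proof (rule integral_Lim_le[OF \<mu> wb])
        \<comment> \<open>Here \<open>N\<close> is fixed while the measure index \<open>k\<close>
          grows, so the estimate needed is \<open>close\<close>, valid eventually along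
          \<open>\<Phi>\<close>, rather than \<open>close_\<sigma>\<close> at one index.\<close>
        have "\<bar>(cmod (h n - P N n))\<^sup>2\<bar> \<le> (M + K N)\<^sup>2" for n using C by (simp add: power_mono)
        from eventually_avg_shifted_avg_le[OF assms(1) \<sigma> this A\<Psi> close \<epsilon>]
        show "\<forall>\<^sub>F k in sequentially. avg (\<Psi> k) (w N) \<le> 2 * \<epsilon> N"
          unfolding w_def \<Psi>_def .
      qed
      show "summable (\<lambda>N. 2 * \<epsilon> N)" unfolding \<epsilon>_eq by (intro summable_mult summable_geometric) simp
    qed
    then have "AE p in \<mu>. besnorm \<Psi> (Rp p h) = besnorm \<Psi> h" using eq sp by (auto elim!: AE_mp)
    \<comment> \<open>Measurability of the equality set is not established, so the witness is the
      complement of a null set containing all exceptions.\<close>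
    then obtain Z where Z: "Z \<in> null_sets \<mu>"
      "{p \<in> space \<mu>. besnorm \<Psi> (Rp p h) \<noteq> besnorm \<Psi> h} \<subseteq> Z"
      unfolding eventually_ae_filter by blast
    have "emeasure \<mu> (space \<mu> - Z) = 1" using Z(1) em by (simp add: emeasure_Diff_null_set)
    then show ?thesis
      using Z(2) sp by (intro bexI[of _ "space \<mu> - Z"] sets.compl_sets null_setsD2[OF Z(1)]) auto
  qed
  with \<sigma> show ?thesis unfolding \<Psi>_def by blast
qed

end
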